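(* Let $n\ge 1$ be an integer. When restricted to the matchings of $[2n]$ with no neighbor crossings, the map $\psi$ (defined in the context) is a bijection onto $\mathcal{T}_n$.
   Context: $[m]=\{1,\dots,m\}$. A matching of $[2n]$ is a partition of $[2n]$ into blocks of size $2$; the blocks are called arcs and written $(i,j)$ with $i<j$; $i$ is the opener and $j$ the closer of the arc. A crossing is a pair of arcs $(i,k)$, $(j,\ell)$ with $i<j<k<\ell$; it is a left-crossing if $j=i+1$ and a right-crossing if $\ell=k+1$. A matching has no neighbor crossings if it has neither left-crossings nor right-crossings. $\mathcal{T}_n$ is the set of upper triangular (square) matrices, of any size, with non-negative integer entries, such that no row or column has only zeros and the total sum of the entries is $n$. Map $\psi$: for a matching $M$ of $[2n]$ let $O(M)$ and $C(M)$ be its sets of openers and closers. Write $O(M)=O_1\cup\dots\cup O_k$ and $C(M)=C_1\cup\dots\cup C_k$ as disjoint unions of maximal intervals of consecutive integers, each list ordered in the natural order (the number $k$ of intervals is the same for openers and closers). Then $\psi(M)=(t_{ij})$ is the $k\times k$ matrix with $t_{ij}=|M\cap (O_i\times C_j)|$, the number of arcs whose opener is in $O_i$ and whose closer is in $C_j$. *)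

theory Defs
  imports "HOL-Library.Disjoint_Sets" "Jordan_Normal_Form.Matrix"
begin

definition matching :: "nat \<Rightarrow> nat set set \<Rightarrow> bool" where
  "matching n M \<longleftrightarrow> partition_on {1..2 * n} M \<and> (\<forall>B\<in>M. card B = 2)"

definition arcs :: "nat set set \<Rightarrow> (nat \<times> nat) set" where
  "arcs M = {(i, j). i < j \<and> {i, j} \<in> M}"

definition openers :: "nat set set \<Rightarrow> nat set" where
  "openers M = fst ` arcs M"

definition closers :: "nat set set \<Rightarrow> nat set" where
  "closers M = snd ` arcs M"

definition crossing :: "nat set set \<Rightarrow> nat \<times> nat \<Rightarrow> nat \<times> nat \<Rightarrow> bool" where
  "crossing M = (\<lambda>(i, k) (j, l). (i, k) \<in> arcs M \<and> (j, l) \<in> arcs M \<and> i < j \<and> j < k \<and> k < l)"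

definition left_crossing :: "nat set set \<Rightarrow> nat \<times> nat \<Rightarrow> nat \<times> nat \<Rightarrow> bool" where
  "left_crossing M = (\<lambda>(i, k) (j, l). crossing M (i, k) (j, l) \<and> j = i + 1)"

definition right_crossing :: "nat set set \<Rightarrow> nat \<times> nat \<Rightarrow> nat \<times> nat \<Rightarrow> bool" where
  "right_crossing M = (\<lambda>(i, k) (j, l). crossing M (i, k) (j, l) \<and> l = k + 1)"

definition no_neighbor_crossings :: "nat set set \<Rightarrow> bool" where
  "no_neighbor_crossings M \<longleftrightarrow>
     (\<nexists>a b. left_crossing M a b) \<and> (\<nexists>a b. right_crossing M a b)"

definition maximal_intervals :: "nat set \<Rightarrow> nat set set" where
  "maximal_intervals S =
     {I. (\<exists>a b. a \<le> b \<and> I = {a..b}) \<and> I \<subseteq> S \<and>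
         (\<forall>c d. I \<subseteq> {c..d} \<and> {c..d} \<subseteq> S \<longrightarrow> {c..d} = I)}"

text \<open>
  Distinct maximal intervals of a set are disjoint, so their natural order is the order of
  their minima.
\<close>
definition interval_list :: "nat set \<Rightarrow> nat set list" where
  "interval_list S = sorted_key_list_of_set Min (maximal_intervals S)"

text \<open>
  For a matching, both interval lists have the same length, so \<open>\<psi> M\<close> is a square matrix.
  Row and column indices start at 0.
\<close>
definition \<psi> :: "nat set set \<Rightarrow> nat mat" where
  "\<psi> M = (let Os = interval_list (openers M); Cs = interval_list (closers M)
          in mat (length Os) (length Cs) (\<lambda>(i, j). card (arcs M \<inter> (Os ! i \<times> Cs ! j))))"

definition \<T> :: "nat \<Rightarrow> nat mat set" where
  "\<T> n = {A. square_mat A \<and> upper_triangular A \<and>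
             (\<forall>i<dim_row A. row A i \<noteq> 0\<^sub>v (dim_col A)) \<and>
             (\<forall>j<dim_col A. col A j \<noteq> 0\<^sub>v (dim_row A)) \<and>
             sum_mat A = n}"

end

theory Submission
  imports Defs
begin

text \<open>
  Read from left to right, the openers and closers of a matching of \<open>{1..2 * n}\<close> form alternating runs
  \<open>O\<^sub>0, C\<^sub>0, O\<^sub>1, C\<^sub>1, \<dots>\<close>, because the first point is an opener and the last one a closer. The
  entry \<open>(a, b)\<close> of \<open>\<psi> M\<close> counts the arcs from \<open>O\<^sub>a\<close> to \<open>C\<^sub>b\<close>. Hence row sums are the lengths of opener
  runs and column sums the lengths of closer runs, and the matrix determines where every run lies.

  Two arcs with adjacent openers are either crossing or nested, and so are two arcs with adjacent
  closers. Without neighbor crossings they are nested, so along each run the other ends of the arcs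
  decrease. This determines the arcs as well: \<open>O\<^sub>a\<close> first contains the arcs to the last closer run,
  then those to the closer run before it, and so on; \<open>C\<^sub>b\<close> is filled in the same way; and the arcs from
  \<open>O\<^sub>a\<close> to \<open>C\<^sub>b\<close> are nested in each other. Both ends of the \<open>m\<close>-th arc from \<open>O\<^sub>a\<close> to \<open>C\<^sub>b\<close> are thus an
  explicit function \<open>place\<close> of \<open>(a, b, m)\<close> and the matrix, and this formula is the inverse of \<open>\<psi>\<close>.

  That it recovers the matching is \<open>nested_diagram_reconstructed\<close>; the counting behind it is
  \<open>position_in_run\<close>. Conversely, for any matrix of \<open>\<T> n\<close> the formula places arcs: positivity of the row
  and column sums keeps the runs nonempty and therefore separated (\<open>alternating_starts\<close>), and
  triangularity puts each opener before its closer (\<open>run_diagram_place\<close>). The result is nested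
  (\<open>nested_diagram_place\<close>) and has the given matrix (\<open>psi_place\<close>).
\<close>

section \<open>Ordered families of separated intervals\<close>

text \<open>
  Between two successive intervals at least one point is missing, so the intervals of such a family
  are exactly the maximal intervals of their union.
\<close>
definition separated :: "nat \<Rightarrow> (nat \<Rightarrow> nat) \<Rightarrow> (nat \<Rightarrow> nat) \<Rightarrow> bool" where
  "separated k l u \<longleftrightarrow> (\<forall>i<k. l i < u i) \<and> (\<forall>i. Suc i < k \<longrightarrow> u i < l (Suc i))"

lemma separated_less:
  assumes "separated k l u" "i < j" "j < k"
  shows "u i < l j"
  using assms(2,3)
proof (induction j)
  case (Suc j)
  have step: "u j < l (Suc j)" "l j < u j" using assms(1) Suc.prems unfolding separated_def by auto
  show ?case
  proof (cases "i = j")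
    case True
    then show ?thesis using step by simp
  next
    case False
    then have "u i < l j" using Suc by simp
    then show ?thesis using step by simp
  qed
qed simp

lemma separated_nonempty: "separated k l u \<Longrightarrow> i < k \<Longrightarrow> l i < u i"
  by (simp add: separated_def)

lemma separated_unique:
  assumes "separated k l u" "i < k" "j < k" "x \<in> {l i..<u i}" "x \<in> {l j..<u j}"
  shows "i = j"
proof (rule ccontr)
  assume "i \<noteq> j"
  then have "u i < l j \<or> u j < l i"
    using separated_less[OF assms(1)] assms(2,3) by (meson linorder_neqE_nat)
  then show False using assms(4,5) by auto
qed

lemma separated_endpoint_notin:
  assumes "separated k l u" "i < k" "j < k"
  shows "u i \<notin> {l j..<u j}"
proof (cases "i < j")
  case True
  then show ?thesis using separated_less[OF assms(1)] assms(3) by fastforce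
next
  case False
  have "u j \<le> u i"
  proof (cases "i = j")
    case neq: False
    then have "u j < l i" using separated_less[OF assms(1), of j i] False assms(2) by simp
    then show ?thesis using separated_nonempty[OF assms(1,2)] by simp
  qed simp
  then show ?thesis by simp
qed

lemma separated_Suc_same:
  assumes sep: "separated k l u" and ij: "i < k" "j < k"
    and x: "x \<in> {l i..<u i}" "Suc x \<in> {l j..<u j}"
  shows "i = j"
proof -
  have "Suc x \<noteq> u i" using separated_endpoint_notin[OF sep ij] x(2) by auto
  then have "Suc x \<in> {l i..<u i}" using x(1) by simp
  then show ?thesis using separated_unique[OF sep ij _ x(2)] by simp
qed

lemma interval_within_block:
  assumes sep: "separated k l u" and ab: "a \<le> b" and sub: "{a..b} \<subseteq> (\<Union>i<k. {l i..<u i})"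
    and i: "i < k" "a \<in> {l i..<u i}"
  shows "{a..b} \<subseteq> {l i..<u i}"
proof -
  have "b < u i"
  proof (rule ccontr)
    assume "\<not> b < u i"
    then have "u i \<in> {a..b}" using i by auto
    then show False using sub separated_endpoint_notin[OF sep i(1)] by blast
  qed
  then show ?thesis using i by auto
qed

lemma maximal_intervals_separated:
  assumes sep: "separated k l u"
  shows "maximal_intervals (\<Union>i<k. {l i..<u i}) = (\<lambda>i. {l i..<u i}) ` {..<k}"
    (is "maximal_intervals ?S = ?B")
proof (intro equalityI subsetI)
  fix I assume I: "I \<in> maximal_intervals ?S"
  then have "(\<exists>a b. a \<le> b \<and> I = {a..b}) \<and> I \<subseteq> ?S"
    and mx: "\<forall>c d. I \<subseteq> {c..d} \<and> {c..d} \<subseteq> ?S \<longrightarrow> {c..d} = I"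
    unfolding maximal_intervals_def by simp_all
  then obtain a b where ab: "a \<le> b" "I = {a..b}" "{a..b} \<subseteq> ?S" by auto
  have "a \<in> ?S" using ab(1) by (intro subsetD[OF ab(3)]) simp
  then obtain i where i: "i < k" "a \<in> {l i..<u i}" by blast
  have eq: "{l i..<u i} = {l i..u i - 1}" using i by auto
  have "I \<subseteq> {l i..u i - 1}" using interval_within_block[OF sep ab(1,3) i] ab(2) eq by simp
  moreover have "{l i..u i - 1} \<subseteq> ?S" using i(1) eq by blast
  ultimately have "{l i..u i - 1} = I" using mx by simp
  then show "I \<in> ?B" using eq i by auto
next
  fix I assume "I \<in> ?B"
  then obtain i where i: "i < k" "I = {l i..<u i}" by blast
  have lu: "l i < u i" using separated_nonempty[OF sep i(1)] .
  have eq: "I = {l i..u i - 1}" using i lu by auto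
  have "{c..d} = I" if cd: "I \<subseteq> {c..d}" "{c..d} \<subseteq> ?S" for c d
  proof -
    have l: "l i \<in> {c..d}" using cd(1) i lu by auto
    then have "c \<in> ?S" by (intro subsetD[OF cd(2)]) simp
    then obtain j where j: "j < k" "c \<in> {l j..<u j}" by blast
    have sub: "{c..d} \<subseteq> {l j..<u j}"
      using interval_within_block[OF sep _ cd(2) j] l by auto
    have "i = j" using separated_unique[OF sep i(1) j(1), of "l i"] l sub lu by auto
    then show ?thesis using sub cd(1) i by auto
  qed
  moreover have "\<exists>a b. a \<le> b \<and> I = {a..b}" using eq lu by (intro exI[of _ "l i"] exI[of _ "u i - 1"]) auto
  moreover have "I \<subseteq> ?S" using i by blast
  ultimately show "I \<in> maximal_intervals ?S"
    unfolding maximal_intervals_def by simp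
qed

lemma (in linorder) sorted_key_list_of_set_eqI:
  assumes "inj_on f (set xs)" "sorted (map f xs)" "distinct xs"
  shows "sorted_key_list_of_set f (set xs) = xs"
proof -
  interpret folding_insort_key "(\<le>)" "(<)" "set xs" f
    by unfold_locales (rule assms(1))
  show ?thesis using assms by (intro idem_if_sorted_distinct) auto
qed

lemma interval_list_separated:
  assumes sep: "separated k l u"
  shows "interval_list (\<Union>i<k. {l i..<u i}) = map (\<lambda>i. {l i..<u i}) [0..<k]"
proof -
  define B where "B = (\<lambda>i. {l i..<u i}) ` {..<k}"
  define xs where "xs = map (\<lambda>i. {l i..<u i}) [0..<k]"
  have lu: "l i < u i" if "i < k" for i using separated_nonempty[OF sep that] .
  have Min: "Min {l i..<u i} = l i" if "i < k" for i
    using lu[OF that] by (intro Min_eqI) auto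
  have less: "l i < l j" if "i < j" "j < k" for i j
    using separated_less[OF sep that] lu[of i] that by simp
  have "map Min xs = map l [0..<k]" unfolding xs_def using Min by simp
  moreover have "sorted_wrt (<) (map l [0..<k])"
    unfolding sorted_wrt_map by (rule sorted_wrt_mono_rel[of _ "(<)"]) (use less in auto)
  ultimately have sd: "sorted_wrt (<) (map Min xs)" by simp
  have set: "set xs = B" unfolding xs_def B_def by (auto simp: atLeast0LessThan)
  have "sorted_key_list_of_set Min (set xs) = xs"
    using sd by (intro sorted_key_list_of_set_eqI) (auto simp: strict_sorted_iff distinct_map)
  then have "sorted_key_list_of_set Min B = xs" unfolding set .
  then show ?thesis
    unfolding B_def xs_def interval_list_def maximal_intervals_separated[OF sep] .
qed

section \<open>Alternating boundaries of opener runs and closer runs\<close>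

text \<open>
  The \<open>a\<close>-th opener run is \<open>{p a..<q a}\<close> and the \<open>a\<close>-th closer run \<open>{q a..<p (Suc a)}\<close>; sharing the boundary
  functions expresses that the runs follow each other without gaps.
\<close>
definition alternating :: "nat \<Rightarrow> (nat \<Rightarrow> nat) \<Rightarrow> (nat \<Rightarrow> nat) \<Rightarrow> bool" where
  "alternating k p q \<longleftrightarrow> (\<forall>a<k. p a < q a \<and> q a < p (Suc a))"

lemma alternating_separated:
  assumes "alternating k p q"
  shows "separated k p q" "separated k q (\<lambda>a. p (Suc a))"
  using assms unfolding alternating_def separated_def by (simp_all add: Suc_lessD)

lemma alternating_mono:
  assumes "alternating k p q" "a \<le> b" "b \<le> k"
  shows "p a \<le> p b"
  using assms(2,3)
proof (induction b)
  case (Suc b)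
  have "p b < q b" "q b < p (Suc b)" using assms(1) Suc.prems(2) unfolding alternating_def by auto
  moreover have "p a \<le> p b" if "a \<noteq> Suc b" using Suc that by simp
  ultimately show ?case by (cases "a = Suc b") auto
qed simp

lemma alternating_union:
  assumes "alternating k p q"
  shows "(\<Union>a<k. {p a..<q a}) \<union> (\<Union>a<k. {q a..<p (Suc a)}) = {p 0..<p k}"
  using assms
proof (induction k)
  case (Suc k)
  then have alt: "alternating k p q" and k: "p k < q k" "q k < p (Suc k)"
    by (auto simp: alternating_def)
  have "p 0 \<le> p k" using alternating_mono[OF alt] by simp
  then have "{p 0..<p (Suc k)} = {p 0..<p k} \<union> ({p k..<q k} \<union> {q k..<p (Suc k)})"
    using k by auto
  then show ?case unfolding Suc.IH[OF alt, symmetric] lessThan_Suc by auto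
qed simp

lemma alternating_disjoint:
  assumes "alternating k p q" "a < k" "b < k"
  shows "{p a..<q a} \<inter> {q b..<p (Suc b)} = {}"
proof -
  have "q a < p (Suc a)" "p b < q b" using assms unfolding alternating_def by auto
  moreover have "p (Suc b) \<le> p a" if "b < a"
    using alternating_mono[OF assms(1), of "Suc b" a] that assms(2) by simp
  moreover have "p (Suc a) \<le> p b" if "a < b"
    using alternating_mono[OF assms(1), of "Suc a" b] that assms(3) by simp
  ultimately show ?thesis by (cases a b rule: linorder_cases) fastforce+
qed

text \<open>
  Here \<open>S\<close> is the set of openers in a word on \<open>{1..<N}\<close> that is empty or starts with an opener and ends
  with a closer. Cutting off the last run of openers, together with the closers behind it, leaves a
  shorter word of the same kind.
\<close>
lemma ex_alternating_boundaries:
  assumes "1 \<le> N" "S \<subseteq> {1..<N}" "1 < N \<longrightarrow> 1 \<in> S \<and> N - 1 \<notin> S"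
  shows "\<exists>k p q. alternating k p q \<and> p 0 = 1 \<and> p k = N \<and> S = (\<Union>a<k. {p a..<q a})"
  using assms
proof (induction N arbitrary: S rule: less_induct)
  case (less N)
  show ?case
  proof (cases "N = 1")
    case True
    then show ?thesis using less.prems
      by (intro exI[of _ 0] exI[of _ "\<lambda>_. 1"]) (auto simp: alternating_def)
  next
    case False
    then have N: "1 < N" "1 \<in> S" "N - 1 \<notin> S" using less.prems by auto
    have fin: "finite S" using less.prems(2) finite_subset by blast
    define e where "e = Suc (Max S)"
    define s where "s = (LEAST x. {x..<e} \<subseteq> S)"
    have Max: "Max S \<in> S" using N(2) fin by (intro Max_in) auto
    have ub: "x < e" if "x \<in> S" for x using Max_ge[OF fin that] by (simp add: e_def)
    have "Max S \<in> {1..<N}" using Max less.prems(2) by blast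
    moreover have "Max S \<noteq> N - 1" using Max N by metis
    ultimately have eN: "e < N" unfolding e_def by auto
    have ms: "{Max S..<e} \<subseteq> S" using Max by (auto simp: e_def)
    have sS: "{s..<e} \<subseteq> S" unfolding s_def by (rule LeastI[of _ "Max S"], rule ms)
    have "s \<le> Max S" unfolding s_def by (rule Least_le, rule ms)
    then have se: "s < e" by (simp add: e_def)
    then have s1: "1 \<le> s" using sS less.prems(2) by force
    \<comment> \<open>The run \<open>{s..<e}\<close> is maximal, so the shorter word on \<open>{1..<s}\<close> again ends with a closer.\<close>
    have gap: "s - 1 \<notin> S" if "1 < s"
    proof
      assume "s - 1 \<in> S"
      moreover have "{s - 1..<e} = insert (s - 1) {s..<e}" using that se by auto
      ultimately have "{s - 1..<e} \<subseteq> S" using sS by simp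
      then have "s \<le> s - 1" unfolding s_def by (rule Least_le)
      then show False using s1 by simp
    qed
    have "\<exists>k p q. alternating k p q \<and> p 0 = 1 \<and> p k = s \<and> S \<inter> {1..<s} = (\<Union>a<k. {p a..<q a})"
      using less.IH[of s "S \<inter> {1..<s}"] se eN s1 gap N(2) by auto
    then obtain k p q where IH: "alternating k p q" "p 0 = 1" "p k = s"
      "S \<inter> {1..<s} = (\<Union>a<k. {p a..<q a})" by blast
    define p' where "p' = p(Suc k := N)"
    define q' where "q' = q(k := e)"
    have "S = (S \<inter> {1..<s}) \<union> {s..<e}"
      using sS ub less.prems(2) by fastforce
    moreover have "(\<Union>a<Suc k. {p' a..<q' a}) = (\<Union>a<k. {p a..<q a}) \<union> {s..<e}"
      using IH(3) by (auto simp: p'_def q'_def lessThan_Suc)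
    ultimately have "S = (\<Union>a<Suc k. {p' a..<q' a})" using IH(4) by simp
    moreover have "alternating (Suc k) p' q'"
      using IH(1,3) se eN by (auto simp: alternating_def p'_def q'_def less_Suc_eq)
    moreover have "p' 0 = 1" "p' (Suc k) = N" using IH by (auto simp: p'_def)
    ultimately show ?thesis by blast
  qed
qed

section \<open>Matchings as sets of arcs\<close>

definition blocks :: "(nat \<times> nat) set \<Rightarrow> nat set set" where
  "blocks R = (\<lambda>(i, j). {i, j}) ` R"

locale arc_diagram =
  fixes n :: nat and R :: "(nat \<times> nat) set"
  assumes opener_less_closer: "(i, j) \<in> R \<Longrightarrow> i < j"
    and inj_fst: "inj_on fst R"
    and inj_snd: "inj_on snd R"
    and disj: "fst ` R \<inter> snd ` R = {}"
    and cover: "fst ` R \<union> snd ` R = {1..2 * n}"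
begin

lemma finite_arcs: "finite R"
  using cover finite_imageD[OF _ inj_fst] by (metis finite_Un finite_atLeastAtMost)

lemma card_arcs: "card R = n"
proof -
  have "2 * n = card (fst ` R \<union> snd ` R)" unfolding cover by simp
  also have "\<dots> = card (fst ` R) + card (snd ` R)"
    using disj finite_arcs by (intro card_Un_disjoint) auto
  also have "\<dots> = 2 * card R" by (simp add: card_image inj_fst inj_snd)
  finally show ?thesis by simp
qed

lemma same_opener: "(i, j) \<in> R \<Longrightarrow> (i, j') \<in> R \<Longrightarrow> j = j'"
  using inj_onD[OF inj_fst, of "(i, j)" "(i, j')"] by simp

lemma same_closer: "(i, j) \<in> R \<Longrightarrow> (i', j) \<in> R \<Longrightarrow> i = i'"
  using inj_onD[OF inj_snd, of "(i, j)" "(i', j)"] by simp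

lemma opener_neq_closer: "(i, j) \<in> R \<Longrightarrow> (i', j') \<in> R \<Longrightarrow> i \<noteq> j'"
  using disj imageI[of "(i, j)" R fst] imageI[of "(i', j')" R snd] by auto

lemma arcs_blocks: "arcs (blocks R) = R"
proof (intro Set.set_eqI iffI)
  fix e assume "e \<in> arcs (blocks R)"
  then obtain i j i' j' where "e = (i, j)" "i < j" "(i', j') \<in> R" "{i, j} = {i', j'}"
    unfolding arcs_def blocks_def by auto
  then show "e \<in> R" using opener_less_closer[of i' j'] by (auto simp: doubleton_eq_iff)
next
  fix e assume "e \<in> R"
  then show "e \<in> arcs (blocks R)"
    using opener_less_closer unfolding arcs_def blocks_def by (cases e) force
qed

lemma matching_blocks: "matching n (blocks R)"
proof -
  have "\<Union>(blocks R) = fst ` R \<union> snd ` R"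
    unfolding blocks_def by force
  moreover have "disjoint (blocks R)"
  proof (rule disjointI)
    fix X Y assume "X \<in> blocks R" "Y \<in> blocks R" "X \<noteq> Y"
    then obtain i j i' j' where a: "(i, j) \<in> R" "(i', j') \<in> R" "X = {i, j}" "Y = {i', j'}"
      and neq: "(i, j) \<noteq> (i', j')"
      unfolding blocks_def by auto
    have "i \<noteq> i'" "j \<noteq> j'" using same_opener same_closer a(1,2) neq by metis+
    moreover have "i \<noteq> j'" "i' \<noteq> j"
      using opener_neq_closer[OF a(1,2)] opener_neq_closer[OF a(2,1)] by simp_all
    ultimately show "X \<inter> Y = {}" using a by auto
  qed
  moreover have "{} \<notin> blocks R" unfolding blocks_def by auto
  moreover have "card B = 2" if "B \<in> blocks R" for B
  proof -
    obtain i j where "(i, j) \<in> R" "B = {i, j}" using \<open>B \<in> blocks R\<close> unfolding blocks_def by auto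
    then show ?thesis using opener_less_closer[of i j] by auto
  qed
  ultimately show ?thesis unfolding matching_def partition_on_def cover by auto
qed

end

lemma matching_arc_diagram:
  assumes M: "matching n M"
  shows "arc_diagram n (arcs M)" "blocks (arcs M) = M"
proof -
  have U: "\<Union>M = {1..2 * n}" and d: "disjoint M" and c: "\<And>B. B \<in> M \<Longrightarrow> card B = 2"
    using M unfolding matching_def partition_on_def by auto
  have eq: "B = B'" if "B \<in> M" "B' \<in> M" "x \<in> B" "x \<in> B'" for B B' x
    using disjointD[OF d] that by blast
  have rep: "\<exists>i j. (i, j) \<in> arcs M \<and> B = {i, j}" if B: "B \<in> M" for B
  proof -
    obtain x y where xy: "B = {x, y}" "x \<noteq> y" using c[OF B] unfolding card_2_iff by blast
    show ?thesis
    proof (cases "x < y")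
      case True
      then show ?thesis using B xy unfolding arcs_def by blast
    next
      case False
      then have "y < x" using xy by simp
      then show ?thesis using B xy unfolding arcs_def
        by (intro exI[of _ y] exI[of _ x]) (auto simp: insert_commute)
    qed
  qed
  show "blocks (arcs M) = M"
  proof
    show "blocks (arcs M) \<subseteq> M" unfolding blocks_def arcs_def by auto
    show "M \<subseteq> blocks (arcs M)" unfolding blocks_def using rep by force
  qed
  show "arc_diagram n (arcs M)"
  proof
    show "i < j" if "(i, j) \<in> arcs M" for i j using that by (simp add: arcs_def)
    show "inj_on fst (arcs M)"
    proof (rule inj_onI, clarsimp)
      fix i j j' assume a: "(i, j) \<in> arcs M" "(i, j') \<in> arcs M"
      then have "{i, j} = {i, j'}" by (intro eq[of _ _ i]) (auto simp: arcs_def)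
      then show "j = j'" by (auto simp: doubleton_eq_iff)
    qed
    show "inj_on snd (arcs M)"
    proof (rule inj_onI, clarsimp)
      fix i i' j assume a: "(i, j) \<in> arcs M" "(i', j) \<in> arcs M"
      then have "{i, j} = {i', j}" by (intro eq[of _ _ j]) (auto simp: arcs_def)
      then show "i = i'" by (auto simp: doubleton_eq_iff)
    qed
    show "fst ` arcs M \<inter> snd ` arcs M = {}"
    proof -
      have False if a: "(i, j) \<in> arcs M" "(h, i) \<in> arcs M" for i j h
      proof -
        have "{i, j} = {h, i}" using a by (intro eq[of _ _ i]) (auto simp: arcs_def)
        then show False using a by (auto simp: doubleton_eq_iff arcs_def)
      qed
      then show ?thesis by force
    qed
    show "fst ` arcs M \<union> snd ` arcs M = {1..2 * n}"
    proof -
      have "fst ` arcs M \<union> snd ` arcs M = \<Union>(blocks (arcs M))"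
        unfolding blocks_def by force
      then show ?thesis using \<open>blocks (arcs M) = M\<close> U by simp
    qed
  qed
qed

text \<open>
  Two arcs whose openers are neighbours, or whose closers are neighbours, either cross or are nested;
  forbidding the crossing forces the nesting.
\<close>
locale nested_diagram = arc_diagram +
  assumes nested_left: "(i, k) \<in> R \<Longrightarrow> (Suc i, l) \<in> R \<Longrightarrow> l < k"
    and nested_right: "(i, k) \<in> R \<Longrightarrow> (j, Suc k) \<in> R \<Longrightarrow> j < i"

lemma (in arc_diagram) no_neighbor_crossings_iff:
  "no_neighbor_crossings (blocks R) \<longleftrightarrow> nested_diagram n R"
proof
  assume nn: "no_neighbor_crossings (blocks R)"
  show "nested_diagram n R"
  proof unfold_locales
    fix i k l assume a: "(i, k) \<in> R" "(Suc i, l) \<in> R"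
    have "Suc i < k" using opener_less_closer[OF a(1)] opener_neq_closer[OF a(2,1)] by simp
    moreover have "k \<noteq> l" using same_closer[of i k "Suc i"] a by auto
    ultimately show "l < k"
      using nn a
      unfolding no_neighbor_crossings_def left_crossing_def crossing_def arcs_blocks
      by (metis (mono_tags, lifting) Suc_eq_plus1 case_prod_conv lessI linorder_neqE_nat)
  next
    fix i k j assume a: "(i, k) \<in> R" "(j, Suc k) \<in> R"
    have "j < k" using opener_less_closer[OF a(2)] opener_neq_closer[OF a(2,1)] by simp
    moreover have "j \<noteq> i" using same_opener[of i k "Suc k"] a by auto
    ultimately show "j < i"
      using nn a
      unfolding no_neighbor_crossings_def right_crossing_def crossing_def arcs_blocks
      by (metis (mono_tags, lifting) Suc_eq_plus1 case_prod_conv lessI linorder_neqE_nat)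
  qed
next
  assume "nested_diagram n R"
  then interpret nested_diagram n R .
  show "no_neighbor_crossings (blocks R)"
    unfolding no_neighbor_crossings_def left_crossing_def right_crossing_def crossing_def arcs_blocks
    by (auto dest: nested_left nested_right)
qed

lemma (in nested_diagram) nested_on_opener_run:
  assumes "(i, k) \<in> R" "(i', k') \<in> R" "i < i'" "{i..i'} \<subseteq> fst ` R"
  shows "k' < k"
  using assms(2-4)
proof (induction i' arbitrary: k')
  case (Suc i')
  show ?case
  proof (cases "i = i'")
    case True
    then show ?thesis using nested_left assms(1) Suc.prems by blast
  next
    case False
    then have "i' \<in> fst ` R" using Suc.prems by auto
    then obtain k'' where "(i', k'') \<in> R" by auto
    then show ?thesis using Suc.IH[of k''] nested_left[of i' k'' k'] Suc.prems False by force
  qed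
qed simp

lemma (in nested_diagram) nested_on_closer_run:
  assumes "(i, k) \<in> R" "(i', k') \<in> R" "k < k'" "{k..k'} \<subseteq> snd ` R"
  shows "i' < i"
  using assms(2-4)
proof (induction k' arbitrary: i')
  case (Suc k')
  show ?case
  proof (cases "k = k'")
    case True
    then show ?thesis using nested_right assms(1) Suc.prems by blast
  next
    case False
    then have "k' \<in> snd ` R" using Suc.prems by auto
    then obtain i'' where "(i'', k') \<in> R" by auto
    then show ?thesis using Suc.IH[of i''] nested_right[of i'' k' i'] Suc.prems False by force
  qed
qed simp

section \<open>Positions inside a run\<close>

text \<open>
  The points of a run are grouped by the run that contains the other end of their arc. In a nested
  diagram the groups come in decreasing order; \<open>h y\<close> is the size of group \<open>y\<close>, and the result is the
  distance of the point of rank \<open>m\<close> in group \<open>b\<close> from the start of the run.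
\<close>
definition offset :: "(nat \<Rightarrow> nat) \<Rightarrow> nat \<Rightarrow> nat \<Rightarrow> nat \<Rightarrow> nat" where
  "offset h k b m = (\<Sum>y\<in>{b<..<k}. h y) + m"

lemma offset_cong:
  "(\<And>y. b < y \<Longrightarrow> y < k \<Longrightarrow> h y = h' y) \<Longrightarrow> offset h k b m = offset h' k b m"
  unfolding offset_def by (intro arg_cong2[of _ _ _ _ "(+)"] sum.cong) auto

lemma offset_less_later:
  assumes "b' < b" "b < k" "m < h b"
  shows "offset h k b m < offset h k b' m'"
proof -
  have "h b + (\<Sum>y\<in>{b<..<k}. h y) = (\<Sum>y\<in>insert b {b<..<k}. h y)" by simp
  also have "\<dots> \<le> (\<Sum>y\<in>{b'<..<k}. h y)" using assms by (intro sum_mono2) auto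
  finally show ?thesis using assms(3) unfolding offset_def by simp
qed

lemma offset_less_iff:
  assumes "b < k" "m < h b" "b' < k" "m' < h b'"
  shows "offset h k b m < offset h k b' m' \<longleftrightarrow> b' < b \<or> b' = b \<and> m < m'"
proof (cases b b' rule: linorder_cases)
  case equal
  then show ?thesis by (simp add: offset_def)
next
  case less
  then show ?thesis using offset_less_later[of b b' k m' h m] assms by simp
next
  case greater
  then show ?thesis using offset_less_later[of b' b k m h m'] assms by simp
qed

lemma offset_eqD:
  assumes "b < k" "m < h b" "b' < k" "m' < h b'" "offset h k b m = offset h k b' m'"
  shows "b = b' \<and> m = m'"
proof -
  have "\<not> offset h k b m < offset h k b' m'" "\<not> offset h k b' m' < offset h k b m"
    using assms(5) by simp_all
  then show ?thesis
    unfolding offset_less_iff[OF assms(1-4)] offset_less_iff[OF assms(3,4,1,2)] by auto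
qed

lemma offset_bound:
  assumes "b < k" "m < h b"
  shows "offset h k b m < (\<Sum>y<k. h y)"
proof -
  have "h b + (\<Sum>y\<in>{b<..<k}. h y) = (\<Sum>y\<in>insert b {b<..<k}. h y)" by simp
  also have "\<dots> \<le> (\<Sum>y<k. h y)" using assms by (intro sum_mono2) auto
  finally show ?thesis using assms(2) unfolding offset_def by simp
qed

lemma offset_surj:
  assumes "v < (\<Sum>y<k. h y)"
  shows "\<exists>b<k. \<exists>m<h b. v = offset h k b m"
proof -
  define D where "D = (SIGMA b:{..<k}. {..<h b})"
  define f where "f = (\<lambda>(b, m). offset h k b m)"
  have inj: "inj_on f D"
  proof (rule inj_onI)
    fix x y assume xy: "x \<in> D" "y \<in> D" "f x = f y"
    obtain b m b' m' where eq: "x = (b, m)" "y = (b', m')" by fastforce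
    show "x = y" using offset_eqD[of b k m h b' m'] xy unfolding eq D_def f_def by simp
  qed
  have "f ` D \<subseteq> {..<\<Sum>y<k. h y}" unfolding D_def f_def using offset_bound by auto
  moreover have "card (f ` D) = (\<Sum>y<k. h y)"
    unfolding card_image[OF inj] by (simp add: D_def)
  ultimately have "f ` D = {..<\<Sum>y<k. h y}" by (intro card_subset_eq) auto
  then have "v \<in> f ` D" using assms by simp
  then show ?thesis unfolding D_def f_def by auto
qed

text \<open>
  The point \<open>f e\<close> is located by counting the points of its run before it. Nesting turns these into the
  arcs whose other end lies beyond that of \<open>e\<close>: all arcs of the groups after group \<open>b\<close>, and the arcs of
  group \<open>b\<close> that come before \<open>f e\<close>. With \<open>f\<close> and \<open>g\<close> being the two projections, this serves openers
  and closers alike.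
\<close>
lemma position_in_run:
  fixes f g :: "'e \<Rightarrow> nat"
  assumes fin: "finite R" and injf: "inj_on f R" and run: "{s..<s'} \<subseteq> f ` R"
    and anti: "\<And>x y. x \<in> R \<Longrightarrow> y \<in> R \<Longrightarrow> f x \<in> {s..<s'} \<Longrightarrow> f y \<in> {s..<s'} \<Longrightarrow> f x < f y \<Longrightarrow> g y < g x"
    and sep: "separated k l u" and cover: "g ` R \<subseteq> (\<Union>b<k. {l b..<u b})"
    and e: "e \<in> R" "f e \<in> {s..<s'}" "b < k" "g e \<in> {l b..<u b}"
  shows "f e = s + offset (\<lambda>y. card {x \<in> R. f x \<in> {s..<s'} \<and> g x \<in> {l y..<u y}}) k b
    (card {x \<in> R. f x \<in> {s..<s'} \<and> g x \<in> {l b..<u b} \<and> f x < f e})"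
proof -
  define N where "N y = {x \<in> R. f x \<in> {s..<s'} \<and> g x \<in> {l y..<u y}}" for y
  define X where "X = {x \<in> R. f x \<in> {s..<s'} \<and> f x < f e}"
  define Y where "Y = {x \<in> R. f x \<in> {s..<s'} \<and> g x \<in> {l b..<u b} \<and> f x < f e}"
  have finN: "finite (N y)" for y unfolding N_def using fin by simp
  have finY: "finite Y" unfolding Y_def using fin by simp
  have X: "X = (\<Union>y\<in>{b<..<k}. N y) \<union> Y"
  proof (intro Set.set_eqI iffI)
    fix x assume x: "x \<in> X"
    then have xR: "x \<in> R" and fx: "f x \<in> {s..<s'}" "f x < f e" unfolding X_def by auto
    have g: "g e < g x" using anti[OF xR e(1) fx(1) e(2) fx(2)] .
    have "g x \<in> (\<Union>b<k. {l b..<u b})" using cover xR by blast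
    then obtain y where y: "y < k" "g x \<in> {l y..<u y}" by blast
    have "\<not> y < b"
    proof
      assume "y < b"
      then have "u y < l b" using separated_less[OF sep] e(3) by simp
      then show False using y(2) e(4) g by simp
    qed
    then show "x \<in> (\<Union>y\<in>{b<..<k}. N y) \<union> Y"
    proof (cases "y = b")
      case True
      then show ?thesis using xR fx y(2) unfolding Y_def by blast
    next
      case False
      then have "y \<in> {b<..<k}" using \<open>\<not> y < b\<close> y(1) by simp
      moreover have "x \<in> N y" using xR fx y(2) unfolding N_def by blast
      ultimately show ?thesis by blast
    qed
  next
    fix x assume "x \<in> (\<Union>y\<in>{b<..<k}. N y) \<union> Y"
    then show "x \<in> X"
    proof
      assume "x \<in> (\<Union>y\<in>{b<..<k}. N y)"
      then obtain y where y: "b < y" "y < k" "x \<in> N y" by auto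
      then have xR: "x \<in> R" and fx: "f x \<in> {s..<s'}" and gx: "g x \<in> {l y..<u y}"
        unfolding N_def by auto
      have "u b < l y" using separated_less[OF sep y(1,2)] .
      then have g: "g e < g x" using gx e(4) by simp
      have "\<not> f e < f x" using anti[OF e(1) xR e(2) fx] g by auto
      moreover have "f e \<noteq> f x" using inj_onD[OF injf _ e(1) xR] g by auto
      ultimately show "x \<in> X" using xR fx unfolding X_def by simp
    next
      assume "x \<in> Y"
      then show "x \<in> X" unfolding X_def Y_def by simp
    qed
  qed
  have disjN: "N y \<inter> N z = {}" if "y < k" "z < k" "y \<noteq> z" for y z
    using separated_unique[OF sep that(1,2)] that(3) unfolding N_def by blast
  have "{s..<f e} = f ` X"
  proof (intro Set.set_eqI iffI)
    fix v assume v: "v \<in> {s..<f e}"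
    then have "v \<in> {s..<s'}" using e(2) by simp
    then obtain x where "x \<in> R" "v = f x" using run by blast
    then show "v \<in> f ` X" using v e(2) unfolding X_def by auto
  qed (auto simp: X_def)
  then have "card {s..<f e} = card X"
    using card_image[OF inj_on_subset[OF injf], of X] unfolding X_def by simp
  also have "\<dots> = card (\<Union>y\<in>{b<..<k}. N y) + card Y"
  proof -
    have "Y \<subseteq> N b" unfolding Y_def N_def by blast
    moreover have "N y \<inter> N b = {}" if "y \<in> {b<..<k}" for y using disjN[of y b] e(3) that by simp
    ultimately have "(\<Union>y\<in>{b<..<k}. N y) \<inter> Y = {}" by blast
    then show ?thesis unfolding X using finN finY by (intro card_Un_disjoint) auto
  qed
  also have "card (\<Union>y\<in>{b<..<k}. N y) = (\<Sum>y\<in>{b<..<k}. card (N y))"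
    by (intro card_UN_disjoint ballI impI) (simp_all add: finN disjN)
  finally have "f e - s = offset (\<lambda>y. card (N y)) k b (card Y)" unfolding offset_def by simp
  moreover have "s \<le> f e" using e(2) by simp
  ultimately show ?thesis unfolding N_def Y_def by linarith
qed

lemma run_length_eq_sum:
  fixes f g :: "'e \<Rightarrow> nat"
  assumes fin: "finite R" and injf: "inj_on f R" and run: "{s..<s'} \<subseteq> f ` R"
    and sep: "separated k l u" and cover: "g ` R \<subseteq> (\<Union>b<k. {l b..<u b})"
  shows "(\<Sum>b<k. card {x \<in> R. f x \<in> {s..<s'} \<and> g x \<in> {l b..<u b}}) = s' - s"
proof -
  define N where "N y = {x \<in> R. f x \<in> {s..<s'} \<and> g x \<in> {l y..<u y}}" for y
  have finN: "finite (N y)" for y unfolding N_def using fin by simp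
  have disjN: "N y \<inter> N z = {}" if "y < k" "z < k" "y \<noteq> z" for y z
    using separated_unique[OF sep that(1,2)] that(3) unfolding N_def by blast
  have "(\<Sum>b<k. card (N b)) = card (\<Union>b\<in>{..<k}. N b)"
    by (intro card_UN_disjoint[symmetric] ballI impI) (simp_all add: finN disjN)
  also have "(\<Union>b\<in>{..<k}. N b) = {x \<in> R. f x \<in> {s..<s'}}"
    using cover unfolding N_def by blast
  also have "card \<dots> = card (f ` {x \<in> R. f x \<in> {s..<s'}})"
    by (rule card_image[OF inj_on_subset[OF injf], symmetric]) blast
  also have "f ` {x \<in> R. f x \<in> {s..<s'}} = {s..<s'}" using run by blast
  finally show ?thesis unfolding N_def by simp
qed

section \<open>The diagram with prescribed block counts\<close>

definition cells :: "nat \<Rightarrow> (nat \<Rightarrow> nat \<Rightarrow> nat) \<Rightarrow> (nat \<times> nat \<times> nat) set" where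
  "cells k t = {(a, b, m). a < k \<and> b < k \<and> m < t a b}"

text \<open>
  The runs alternate from position 1 on; a row sum of \<open>t\<close> is the length of an opener run, and a column
  sum that of a closer run.
\<close>
definition opener_run_start :: "nat \<Rightarrow> (nat \<Rightarrow> nat \<Rightarrow> nat) \<Rightarrow> nat \<Rightarrow> nat" where
  "opener_run_start k t a = 1 + (\<Sum>x<a. (\<Sum>y<k. t x y) + (\<Sum>y<k. t y x))"

definition closer_run_start :: "nat \<Rightarrow> (nat \<Rightarrow> nat \<Rightarrow> nat) \<Rightarrow> nat \<Rightarrow> nat" where
  "closer_run_start k t a = opener_run_start k t a + (\<Sum>y<k. t a y)"

text \<open>
  The \<open>m\<close>-th arc from opener run \<open>a\<close> to closer run \<open>b\<close>, where \<open>m = 0\<close> is the outermost one. As these arcs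
  are nested, their closers appear in the reverse order of their openers, which explains the rank
  \<open>t a b - Suc m\<close> at the closer.
\<close>
definition place :: "nat \<Rightarrow> (nat \<Rightarrow> nat \<Rightarrow> nat) \<Rightarrow> nat \<times> nat \<times> nat \<Rightarrow> nat \<times> nat" where
  "place k t = (\<lambda>(a, b, m).
     (opener_run_start k t a + offset (t a) k b m,
      closer_run_start k t b + offset (\<lambda>x. t x b) k a (t a b - Suc m)))"

definition diagram_of :: "nat mat \<Rightarrow> (nat \<times> nat) set" where
  "diagram_of A = place (dim_row A) (\<lambda>a b. A $$ (a, b)) ` cells (dim_row A) (\<lambda>a b. A $$ (a, b))"

lemma cells_Sigma: "cells k t = (SIGMA a:{..<k}. SIGMA b:{..<k}. {..<t a b})"
  unfolding cells_def by auto

lemma finite_cells: "finite (cells k t)"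
  unfolding cells_Sigma by (intro finite_SigmaI) auto

lemma card_cells: "card (cells k t) = (\<Sum>a<k. \<Sum>b<k. t a b)"
  unfolding cells_Sigma by simp

lemma opener_run_start_Suc:
  "opener_run_start k t (Suc a) = closer_run_start k t a + (\<Sum>y<k. t y a)"
  unfolding closer_run_start_def opener_run_start_def by simp

lemma opener_run_start_cong:
  assumes "a \<le> k" "\<And>x y. x < k \<Longrightarrow> y < k \<Longrightarrow> t x y = t' x y"
  shows "opener_run_start k t a = opener_run_start k t' a"
proof -
  have "(\<Sum>y<k. t x y) = (\<Sum>y<k. t' x y)" "(\<Sum>y<k. t y x) = (\<Sum>y<k. t' y x)" if "x < a" for x
    using assms that by (auto intro!: sum.cong)
  then show ?thesis unfolding opener_run_start_def by simp
qed

lemma closer_run_start_cong: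
  assumes "a < k" "\<And>x y. x < k \<Longrightarrow> y < k \<Longrightarrow> t x y = t' x y"
  shows "closer_run_start k t a = closer_run_start k t' a"
proof -
  have "(\<Sum>y<k. t a y) = (\<Sum>y<k. t' a y)" using assms by (intro sum.cong) auto
  then show ?thesis
    unfolding closer_run_start_def using opener_run_start_cong[of a k t t'] assms by simp
qed

lemma place_cells_cong:
  assumes "\<And>x y. x < k \<Longrightarrow> y < k \<Longrightarrow> t x y = t' x y"
  shows "place k t ` cells k t = place k t' ` cells k t'"
proof (rule image_cong)
  show "cells k t = cells k t'" unfolding cells_def using assms by auto
  fix c assume "c \<in> cells k t'"
  then obtain a b m where c: "c = (a, b, m)" "a < k" "b < k" unfolding cells_def by auto
  have "offset (t a) k b m = offset (t' a) k b m"
    using assms c by (intro offset_cong) auto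
  moreover have "offset (\<lambda>x. t x b) k a m' = offset (\<lambda>x. t' x b) k a m'" for m'
    using assms c by (intro offset_cong) auto
  moreover have "opener_run_start k t a = opener_run_start k t' a"
    using assms c by (intro opener_run_start_cong) auto
  moreover have "closer_run_start k t b = closer_run_start k t' b"
    using assms c by (intro closer_run_start_cong) auto
  ultimately show "place k t c = place k t' c"
    unfolding c(1) place_def using assms c by simp
qed

section \<open>Diagrams with known runs\<close>

locale run_diagram = arc_diagram +
  fixes k :: nat and p q :: "nat \<Rightarrow> nat"
  assumes alternating: "alternating k p q"
    and first: "p 0 = 1"
    and opener_runs: "fst ` R = (\<Union>a<k. {p a..<q a})"
    and closer_runs: "snd ` R = (\<Union>a<k. {q a..<p (Suc a)})"
begin

lemmas opener_sep = alternating_separated(1)[OF alternating]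
lemmas closer_sep = alternating_separated(2)[OF alternating]

definition count :: "nat \<Rightarrow> nat \<Rightarrow> nat" where
  "count a b = card (R \<inter> ({p a..<q a} \<times> {q b..<p (Suc b)}))"

lemma count_alt:
  "count a b = card {x \<in> R. fst x \<in> {p a..<q a} \<and> snd x \<in> {q b..<p (Suc b)}}"
  "count a b = card {x \<in> R. snd x \<in> {q b..<p (Suc b)} \<and> fst x \<in> {p a..<q a}}"
  unfolding count_def by (rule arg_cong[of _ _ card], auto)+

lemma row_sum: "a < k \<Longrightarrow> (\<Sum>b<k. count a b) = q a - p a"
  unfolding count_alt(1)
  by (rule run_length_eq_sum[OF finite_arcs inj_fst _ closer_sep])
    (auto simp: opener_runs closer_runs)

lemma column_sum: "b < k \<Longrightarrow> (\<Sum>a<k. count a b) = p (Suc b) - q b"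
  unfolding count_alt(2)
  by (rule run_length_eq_sum[OF finite_arcs inj_snd _ opener_sep])
    (auto simp: opener_runs closer_runs)

lemma total_count: "(\<Sum>a<k. \<Sum>b<k. count a b) = n"
proof -
  have "n = card (fst ` R)" by (simp add: card_image inj_fst card_arcs)
  also have "\<dots> = (\<Sum>a<k. card {p a..<q a})"
    unfolding opener_runs
  proof (rule card_UN_disjoint, goal_cases)
    case 3
    show ?case using separated_unique[OF opener_sep] by blast
  qed auto
  finally show ?thesis using row_sum by simp
qed

text \<open>If \<open>b < a\<close>, closer run \<open>b\<close> ends before opener run \<open>a\<close> begins.\<close>
lemma count_below_diagonal:
  assumes "b < a" "a < k"
  shows "count a b = 0"
proof -
  have "p (Suc b) \<le> p a" using alternating_mono[OF alternating, of "Suc b" a] assms by simp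
  then have "R \<inter> ({p a..<q a} \<times> {q b..<p (Suc b)}) = {}"
    using opener_less_closer by fastforce
  then show ?thesis unfolding count_def by simp
qed

lemma run_nonempty: "a < k \<Longrightarrow> p a < q a" "a < k \<Longrightarrow> q a < p (Suc a)"
  using alternating unfolding alternating_def by auto

lemma opener_run_start_count: "a \<le> k \<Longrightarrow> opener_run_start k count a = p a"
proof (induction a)
  case 0
  then show ?case using first by (simp add: opener_run_start_def)
next
  case (Suc a)
  then show ?case
    using row_sum[of a] column_sum[of a] run_nonempty[of a]
    by (simp add: opener_run_start_Suc closer_run_start_def)
qed

lemma closer_run_start_count: "a < k \<Longrightarrow> closer_run_start k count a = q a"
  using opener_run_start_count[of a] row_sum[of a] run_nonempty[of a]
  by (simp add: closer_run_start_def)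

lemma psi_blocks: "\<psi> (blocks R) = mat k k (\<lambda>(a, b). count a b)"
proof -
  have "openers (blocks R) = (\<Union>a<k. {p a..<q a})" "closers (blocks R) = (\<Union>a<k. {q a..<p (Suc a)})"
    unfolding openers_def closers_def arcs_blocks opener_runs closer_runs by simp_all
  then have "interval_list (openers (blocks R)) = map (\<lambda>a. {p a..<q a}) [0..<k]"
    "interval_list (closers (blocks R)) = map (\<lambda>a. {q a..<p (Suc a)}) [0..<k]"
    using interval_list_separated[OF opener_sep] interval_list_separated[OF closer_sep] by simp_all
  then show ?thesis
    unfolding \<psi>_def Let_def arcs_blocks by (intro eq_matI) (auto simp: count_def)
qed

lemma psi_in_T: "\<psi> (blocks R) \<in> \<T> n"
proof -
  define A where "A = mat k k (\<lambda>(a, b). count a b)"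
  have A: "A \<in> carrier_mat k k" "\<And>a b. a < k \<Longrightarrow> b < k \<Longrightarrow> A $$ (a, b) = count a b"
    unfolding A_def by auto
  have "row A a \<noteq> 0\<^sub>v k" if a: "a < k" for a
  proof
    assume "row A a = 0\<^sub>v k"
    then have "count a b = 0" if "b < k" for b
      using A a that by (metis carrier_matD index_row(1) index_zero_vec(1))
    then show False using row_sum[OF a] run_nonempty(1)[OF a] by simp
  qed
  moreover have "col A b \<noteq> 0\<^sub>v k" if b: "b < k" for b
  proof
    assume "col A b = 0\<^sub>v k"
    then have "count a b = 0" if "a < k" for a
      using A b that by (metis carrier_matD index_col index_zero_vec(1))
    then show False using column_sum[OF b] run_nonempty(2)[OF b] by simp
  qed
  moreover have "upper_triangular A"
    using A count_below_diagonal by (intro upper_triangularI) auto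
  moreover have "sum_mat A = n"
  proof -
    have "sum_mat A = (\<Sum>(a, b)\<in>{..<k} \<times> {..<k}. count a b)"
      unfolding sum_mat_def using A by (intro sum.cong) auto
    then show ?thesis using total_count by (simp add: sum.cartesian_product)
  qed
  ultimately show ?thesis
    unfolding psi_blocks A_def[symmetric] \<T>_def using A(1) by auto
qed

end

text \<open>
  The smallest point cannot be a closer and the largest cannot be an opener, so the runs start with
  openers and end with closers.
\<close>
lemma (in arc_diagram) ex_runs:
  "\<exists>k p q. run_diagram n R k p q"
proof -
  have "\<exists>k p q. alternating k p q \<and> p 0 = 1 \<and> p k = Suc (2 * n) \<and> fst ` R = (\<Union>a<k. {p a..<q a})"
  proof (rule ex_alternating_boundaries)
    show "fst ` R \<subseteq> {1..<Suc (2 * n)}"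
      unfolding atLeastLessThanSuc_atLeastAtMost cover[symmetric] by blast
    show "1 < Suc (2 * n) \<longrightarrow> 1 \<in> fst ` R \<and> Suc (2 * n) - 1 \<notin> fst ` R"
    proof (intro impI conjI)
      assume n: "1 < Suc (2 * n)"
      have "1 \<notin> snd ` R"
      proof
        assume "1 \<in> snd ` R"
        then obtain i where i: "(i, 1) \<in> R" by auto
        then have "i \<in> fst ` R" by force
        then have "1 \<le> i" using cover by auto
        then show False using opener_less_closer[OF i] by simp
      qed
      moreover have "1 \<in> fst ` R \<union> snd ` R" unfolding cover using n by simp
      ultimately show "1 \<in> fst ` R" by blast
      show "Suc (2 * n) - 1 \<notin> fst ` R"
      proof
        assume "Suc (2 * n) - 1 \<in> fst ` R"
        then obtain j where j: "(2 * n, j) \<in> R" by auto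
        then have "j \<in> snd ` R" by force
        then have "j \<le> 2 * n" using cover by auto
        then show False using opener_less_closer[OF j] by simp
      qed
    qed
  qed simp
  then obtain k p q where alt: "alternating k p q" "p 0 = 1" "p k = Suc (2 * n)"
    and O: "fst ` R = (\<Union>a<k. {p a..<q a})" by blast
  have "(\<Union>a<k. {p a..<q a}) \<inter> (\<Union>a<k. {q a..<p (Suc a)}) = {}"
    using alternating_disjoint[OF alt(1)] by blast
  moreover have "(\<Union>a<k. {p a..<q a}) \<union> (\<Union>a<k. {q a..<p (Suc a)}) = fst ` R \<union> snd ` R"
    unfolding alternating_union[OF alt(1)] cover alt by auto
  moreover have "T = T'" if "S \<inter> T = {}" "S \<inter> T' = {}" "S \<union> T' = S \<union> T" for S T T' :: "nat set"
    using that by blast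
  ultimately have "snd ` R = (\<Union>a<k. {q a..<p (Suc a)})"
    using disj unfolding O by meson
  then have "run_diagram n R k p q" using alt O by unfold_locales
  then show ?thesis by blast
qed

text \<open>
  Nesting leaves no freedom: the two runs of an arc and its rank among the arcs between these runs
  determine both of its ends. As there are as many arcs as such places, all places are taken.
\<close>
lemma nested_diagram_reconstructed:
  assumes "nested_diagram n R"
  shows "diagram_of (\<psi> (blocks R)) = R"
proof -
  interpret nested_diagram n R by (rule assms)
  obtain k p q where "run_diagram n R k p q" using ex_runs by blast
  then interpret run_diagram n R k p q .
  have sub: "R \<subseteq> place k count ` cells k count"
  proof
    fix e assume e: "e \<in> R"
    obtain i j where ij: "e = (i, j)" by fastforce
    have "i \<in> fst ` R" "j \<in> snd ` R" using e ij by force+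
    then obtain a b where a: "a < k" "fst e \<in> {p a..<q a}" and b: "b < k" "snd e \<in> {q b..<p (Suc b)}"
      unfolding opener_runs closer_runs ij by auto
    have Oa: "{p a..<q a} \<subseteq> fst ` R" using a unfolding opener_runs by blast
    have Cb: "{q b..<p (Suc b)} \<subseteq> snd ` R" using b unfolding closer_runs by blast
    have anti_fst: "snd y < snd x" if "x \<in> R" "y \<in> R" "fst x \<in> {p a..<q a}" "fst y \<in> {p a..<q a}"
      "fst x < fst y" for x y
    proof -
      have "{fst x..fst y} \<subseteq> fst ` R" using that Oa by force
      then show ?thesis using nested_on_opener_run[of "fst x" "snd x" "fst y" "snd y"] that by simp
    qed
    have anti_snd: "fst y < fst x" if "x \<in> R" "y \<in> R" "snd x \<in> {q b..<p (Suc b)}"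
      "snd y \<in> {q b..<p (Suc b)}" "snd x < snd y" for x y
    proof -
      have "{snd x..snd y} \<subseteq> snd ` R" using that Cb by force
      then show ?thesis using nested_on_closer_run[of "fst x" "snd x" "fst y" "snd y"] that by simp
    qed
    \<comment> \<open>Apart from \<open>e\<close>, the arcs between the two runs of \<open>e\<close> are those around \<open>e\<close> (\<open>B1\<close>) and those below
      \<open>e\<close> (\<open>B2\<close>). The first set gives the rank of the opener of \<open>e\<close>, the second that of its closer, so
      the two ranks are complementary.\<close>
    define B where "B = {x \<in> R. fst x \<in> {p a..<q a} \<and> snd x \<in> {q b..<p (Suc b)}}"
    define B1 where "B1 = {x \<in> R. fst x \<in> {p a..<q a} \<and> snd x \<in> {q b..<p (Suc b)} \<and> fst x < fst e}"
    define B2 where "B2 = {x \<in> R. snd x \<in> {q b..<p (Suc b)} \<and> fst x \<in> {p a..<q a} \<and> snd x < snd e}"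
    have i: "fst e = p a + offset (count a) k b (card B1)"
      using position_in_run[where f = fst and g = snd, OF finite_arcs inj_fst Oa anti_fst closer_sep _ e a(2) b]
      unfolding B1_def count_alt(1)[abs_def] closer_runs by simp
    have j: "snd e = q b + offset (\<lambda>x. count x b) k a (card B2)"
      using position_in_run[where f = snd and g = fst, OF finite_arcs inj_snd Cb anti_snd opener_sep _ e b(2) a]
      unfolding B2_def count_alt(2)[abs_def] opener_runs by simp
    have "B = insert e (B1 \<union> B2)"
    proof (intro Set.set_eqI iffI)
      fix x assume x: "x \<in> B"
      show "x \<in> insert e (B1 \<union> B2)"
      proof (cases "fst x" "fst e" rule: linorder_cases)
        case less
        then show ?thesis using x unfolding B_def B1_def by blast
      next
        case equal
        then show ?thesis using x inj_onD[OF inj_fst equal _ e] unfolding B_def by blast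
      next
        case greater
        then have "snd x < snd e" using anti_fst[OF e _ a(2) _ greater] x unfolding B_def by blast
        then show ?thesis using x unfolding B_def B2_def by blast
      qed
    next
      fix x assume "x \<in> insert e (B1 \<union> B2)"
      then show "x \<in> B" using e a b unfolding B_def B1_def B2_def by blast
    qed
    moreover have "B1 \<inter> B2 = {}"
    proof -
      have "snd e < snd x" if "x \<in> B1" for x
        using anti_fst[of x e] that e a(2) unfolding B1_def by blast
      then show ?thesis unfolding B2_def by fastforce
    qed
    moreover have "e \<notin> B1" "e \<notin> B2" unfolding B1_def B2_def by simp_all
    moreover have "finite B1" "finite B2" unfolding B1_def B2_def using finite_arcs by simp_all
    ultimately have "card B = Suc (card B1 + card B2)" by (simp add: card_Un_disjoint)
    then have c: "count a b = Suc (card B1 + card B2)" unfolding count_alt(1) B_def .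
    have "e = place k count (a, b, card B1)"
      unfolding place_def using i j c opener_run_start_count[of a] closer_run_start_count[of b] a b
      by (intro prod_eqI) simp_all
    moreover have "(a, b, card B1) \<in> cells k count" unfolding cells_def using a b c by simp
    ultimately show "e \<in> place k count ` cells k count" by blast
  qed
  have "card (place k count ` cells k count) \<le> card R"
    using card_image_le[OF finite_cells, of "place k count" k count]
    unfolding card_cells total_count card_arcs .
  then have "R = place k count ` cells k count"
    using sub finite_cells by (intro card_seteq) auto
  also have "\<dots> = diagram_of (\<psi> (blocks R))"
  proof -
    have "dim_row (\<psi> (blocks R)) = k" unfolding psi_blocks by simp
    then show ?thesis unfolding diagram_of_def
      using place_cells_cong[of k count "\<lambda>a b. \<psi> (blocks R) $$ (a, b)"] psi_blocks by simp
  qed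
  finally show ?thesis ..
qed

section \<open>Realizing every upper triangular matrix\<close>

locale block_counts =
  fixes k :: nat and t :: "nat \<Rightarrow> nat \<Rightarrow> nat"
  assumes triangular: "b < a \<Longrightarrow> a < k \<Longrightarrow> t a b = 0"
    and row_pos: "a < k \<Longrightarrow> 0 < (\<Sum>b<k. t a b)"
    and col_pos: "b < k \<Longrightarrow> 0 < (\<Sum>a<k. t a b)"
begin

abbreviation "p \<equiv> opener_run_start k t"
abbreviation "q \<equiv> closer_run_start k t"
abbreviation "R \<equiv> place k t ` cells k t"

lemma q_eq: "q a = p a + (\<Sum>b<k. t a b)"
  by (simp add: closer_run_start_def)

lemma alternating_starts: "alternating k p q"
  unfolding alternating_def q_eq opener_run_start_Suc using row_pos col_pos by simp

lemmas opener_starts_sep = alternating_separated(1)[OF alternating_starts]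
lemmas closer_starts_sep = alternating_separated(2)[OF alternating_starts]

lemma fst_place:
  assumes "(a, b, m) \<in> cells k t"
  shows "fst (place k t (a, b, m)) \<in> {p a..<q a}"
  using offset_bound[of b k m "t a"] assms unfolding place_def q_eq cells_def by simp

lemma snd_place:
  assumes "(a, b, m) \<in> cells k t"
  shows "snd (place k t (a, b, m)) \<in> {q b..<p (Suc b)}"
  using offset_bound[of a k "t a b - Suc m" "\<lambda>x. t x b"] assms
  unfolding place_def opener_run_start_Suc cells_def by simp

lemma inj_fst_place: "inj_on (fst \<circ> place k t) (cells k t)"
proof (rule inj_onI)
  fix c c' assume c: "c \<in> cells k t" "c' \<in> cells k t" "(fst \<circ> place k t) c = (fst \<circ> place k t) c'"
  obtain a b m a' b' m' where eq: "c = (a, b, m)" "c' = (a', b', m')"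
    by (cases c, cases c') auto
  have lt: "a < k" "b < k" "m < t a b" "a' < k" "b' < k" "m' < t a' b'"
    using c unfolding eq cells_def by auto
  have "a = a'"
    using separated_unique[OF opener_starts_sep lt(1,4) fst_place] fst_place[of a' b' m'] c
    unfolding eq by simp
  moreover have "b = b' \<and> m = m'"
    using offset_eqD[of b k m "t a" b' m'] c lt \<open>a = a'\<close> unfolding eq place_def by simp
  ultimately show "c = c'" unfolding eq by simp
qed

lemma inj_snd_place: "inj_on (snd \<circ> place k t) (cells k t)"
proof (rule inj_onI)
  fix c c' assume c: "c \<in> cells k t" "c' \<in> cells k t" "(snd \<circ> place k t) c = (snd \<circ> place k t) c'"
  obtain a b m a' b' m' where eq: "c = (a, b, m)" "c' = (a', b', m')"
    by (cases c, cases c') auto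
  have lt: "a < k" "b < k" "m < t a b" "a' < k" "b' < k" "m' < t a' b'"
    using c unfolding eq cells_def by auto
  have "b = b'"
    using separated_unique[OF closer_starts_sep lt(2,5) snd_place] snd_place[of a' b' m'] c
    unfolding eq by simp
  have am: "a = a' \<and> t a b - Suc m = t a' b - Suc m'"
  proof (rule offset_eqD[of a k _ "\<lambda>x. t x b"])
    show "offset (\<lambda>x. t x b) k a (t a b - Suc m) = offset (\<lambda>x. t x b) k a' (t a' b - Suc m')"
      using c(3) \<open>b = b'\<close> unfolding eq place_def by simp
  qed (use lt \<open>b = b'\<close> in auto)
  have "m = m'"
    using am lt(3,6) \<open>b = b'\<close> by (metis Suc_diff_Suc diff_diff_cancel less_imp_le Suc_inject)
  then show "c = c'" using am \<open>b = b'\<close> unfolding eq by simp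
qed

lemma fst_R: "fst ` R = (\<Union>a<k. {p a..<q a})"
proof (intro equalityI subsetI)
  fix v assume "v \<in> fst ` R"
  then obtain a b m where "(a, b, m) \<in> cells k t" "v = fst (place k t (a, b, m))" by auto
  then show "v \<in> (\<Union>a<k. {p a..<q a})" using fst_place[of a b m] unfolding cells_def by auto
next
  fix v assume "v \<in> (\<Union>a<k. {p a..<q a})"
  then obtain a where a: "a < k" "v \<in> {p a..<q a}" by blast
  then have "v - p a < (\<Sum>b<k. t a b)" unfolding q_eq by auto
  then obtain b m where bm: "b < k" "m < t a b" "v - p a = offset (t a) k b m"
    using offset_surj by blast
  have "p a \<le> v" using a(2) by simp
  then have "v = fst (place k t (a, b, m))" using bm(3) unfolding place_def by simp
  moreover have "(a, b, m) \<in> cells k t" using a bm unfolding cells_def by simp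
  ultimately show "v \<in> fst ` R" by blast
qed

lemma snd_R: "snd ` R = (\<Union>b<k. {q b..<p (Suc b)})"
proof (intro equalityI subsetI)
  fix v assume "v \<in> snd ` R"
  then obtain a b m where "(a, b, m) \<in> cells k t" "v = snd (place k t (a, b, m))" by auto
  then show "v \<in> (\<Union>b<k. {q b..<p (Suc b)})" using snd_place[of a b m] unfolding cells_def by auto
next
  fix v assume "v \<in> (\<Union>b<k. {q b..<p (Suc b)})"
  then obtain b where b: "b < k" "v \<in> {q b..<p (Suc b)}" by blast
  then have "v - q b < (\<Sum>a<k. t a b)" unfolding opener_run_start_Suc by auto
  then obtain a m where am: "a < k" "m < t a b" "v - q b = offset (\<lambda>a. t a b) k a m"
    using offset_surj[of "v - q b" "\<lambda>a. t a b" k] by blast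
  have "t a b - Suc (t a b - Suc m) = m" using am(2) by simp
  moreover have "q b \<le> v" using b(2) by simp
  ultimately have "v = snd (place k t (a, b, t a b - Suc m))" using am(3) unfolding place_def by simp
  moreover have "(a, b, t a b - Suc m) \<in> cells k t" using am b unfolding cells_def by simp
  ultimately show "v \<in> snd ` R" by blast
qed

lemma opener_starts_end: "p k = Suc (2 * (\<Sum>a<k. \<Sum>b<k. t a b))"
  unfolding opener_run_start_def
  by (simp add: sum.distrib sum.swap[of "\<lambda>x y. t y x" "{..<k}" "{..<k}"])

lemma run_diagram_place:
  assumes "(\<Sum>a<k. \<Sum>b<k. t a b) = n"
  shows "run_diagram n R k p q"
proof
  show "i < j" if "(i, j) \<in> R" for i j
  proof -
    obtain a b m where c: "(a, b, m) \<in> cells k t" "(i, j) = place k t (a, b, m)"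
      using \<open>(i, j) \<in> R\<close> by auto
    have lt: "a < k" "b < k" "t a b \<noteq> 0" using c(1) unfolding cells_def by auto
    then have "a \<le> b" using triangular[of b a] by (meson not_le)
    have "q a \<le> q b"
    proof (cases "a = b")
      case False
      then have "p (Suc a) < q b"
        using separated_less[OF closer_starts_sep, of a b] \<open>a \<le> b\<close> lt by simp
      moreover have "q a < p (Suc a)" using alternating_starts lt unfolding alternating_def by simp
      ultimately show ?thesis by simp
    qed simp
    then show "i < j" using fst_place[OF c(1)] snd_place[OF c(1)] unfolding c(2)[symmetric] by simp
  qed
  show "inj_on fst R" using inj_fst_place by (rule inj_on_imageI)
  show "inj_on snd R" using inj_snd_place by (rule inj_on_imageI)
  show "fst ` R \<inter> snd ` R = {}"
    unfolding fst_R snd_R using alternating_disjoint[OF alternating_starts] by blast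
  have "p 0 = 1" by (simp add: opener_run_start_def)
  then show "p 0 = 1" .
  show "fst ` R \<union> snd ` R = {1..2 * n}"
    unfolding fst_R snd_R alternating_union[OF alternating_starts] opener_starts_end assms \<open>p 0 = 1\<close>
    by (rule atLeastLessThanSuc_atLeastAtMost)
qed (fact alternating_starts fst_R snd_R)+

text \<open>
  Neighbouring openers lie in the same run, where a later position means an earlier closer run or, for
  the same closer run, a larger \<open>m\<close>; either way the later opener has the earlier closer. The situation
  at neighbouring closers is symmetric.
\<close>
lemma nested_diagram_place:
  assumes "(\<Sum>a<k. \<Sum>b<k. t a b) = n"
  shows "nested_diagram n R"
proof -
  interpret run_diagram n R k p q by (rule run_diagram_place[OF assms])
  show ?thesis
  proof unfold_locales
    fix i j l assume ij: "(i, j) \<in> R" "(Suc i, l) \<in> R"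
    obtain a b m where c: "(a, b, m) \<in> cells k t" "(i, j) = place k t (a, b, m)" using ij(1) by auto
    obtain a' b' m' where c': "(a', b', m') \<in> cells k t" "(Suc i, l) = place k t (a', b', m')"
      using ij(2) by auto
    have lt: "a < k" "b < k" "m < t a b" "a' < k" "b' < k" "m' < t a' b'"
      using c(1) c'(1) unfolding cells_def by auto
    have a: "a = a'"
      using separated_Suc_same[OF opener_starts_sep lt(1,4), of i] fst_place[OF c(1)] fst_place[OF c'(1)]
      unfolding c(2)[symmetric] c'(2)[symmetric] by simp
    have "offset (t a) k b m < offset (t a) k b' m'"
      using c(2) c'(2) unfolding place_def a by simp
    then consider "b' < b" | "b' = b" "m < m'"
      using offset_less_iff[of b k m "t a" b' m'] lt a by auto
    then show "l < j"
    proof cases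
      case 1
      then show ?thesis
        using separated_less[OF closer_starts_sep 1 lt(2)] snd_place[OF c(1)] snd_place[OF c'(1)]
        unfolding c(2)[symmetric] c'(2)[symmetric] by simp
    next
      case 2
      then show ?thesis using c(2) c'(2) a lt unfolding place_def offset_def by simp
    qed
  next
    fix i j h assume ij: "(i, j) \<in> R" "(h, Suc j) \<in> R"
    obtain a b m where c: "(a, b, m) \<in> cells k t" "(i, j) = place k t (a, b, m)" using ij(1) by auto
    obtain a' b' m' where c': "(a', b', m') \<in> cells k t" "(h, Suc j) = place k t (a', b', m')"
      using ij(2) by auto
    have lt: "a < k" "b < k" "m < t a b" "a' < k" "b' < k" "m' < t a' b'"
      using c(1) c'(1) unfolding cells_def by auto
    have b: "b = b'"
      using separated_Suc_same[OF closer_starts_sep lt(2,5), of j] snd_place[OF c(1)] snd_place[OF c'(1)]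
      unfolding c(2)[symmetric] c'(2)[symmetric] by simp
    have "offset (\<lambda>x. t x b) k a (t a b - Suc m) < offset (\<lambda>x. t x b) k a' (t a' b - Suc m')"
      using c(2) c'(2) unfolding place_def b by simp
    then consider "a' < a" | "a' = a" "t a b - Suc m < t a b - Suc m'"
      using offset_less_iff[of a k "t a b - Suc m" "\<lambda>x. t x b" a' "t a' b - Suc m'"] lt b by auto
    then show "h < i"
    proof cases
      case 1
      then show ?thesis
        using separated_less[OF opener_starts_sep 1 lt(1)] fst_place[OF c(1)] fst_place[OF c'(1)]
        unfolding c(2)[symmetric] c'(2)[symmetric] by simp
    next
      case 2
      then show ?thesis using c(2) c'(2) b lt unfolding place_def offset_def by simp
    qed
  qed
qed

lemma psi_place: "\<psi> (blocks R) = mat k k (\<lambda>(a, b). t a b)"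
proof -
  interpret run_diagram "\<Sum>a<k. \<Sum>b<k. t a b" R k p q by (rule run_diagram_place[OF refl])
  have "count a b = t a b" if ab: "a < k" "b < k" for a b
  proof -
    have "R \<inter> ({p a..<q a} \<times> {q b..<p (Suc b)}) = (\<lambda>m. place k t (a, b, m)) ` {..<t a b}"
    proof (intro equalityI subsetI)
      fix e assume e: "e \<in> R \<inter> ({p a..<q a} \<times> {q b..<p (Suc b)})"
      then obtain a' b' m where c: "(a', b', m) \<in> cells k t" "e = place k t (a', b', m)" by auto
      then have lt: "a' < k" "b' < k" "m < t a' b'" unfolding cells_def by auto
      have "fst e \<in> {p a..<q a}" "snd e \<in> {q b..<p (Suc b)}"
        using e unfolding Int_iff mem_Times_iff by simp_all
      then have "a' = a" "b' = b"
        using separated_unique[OF opener_starts_sep lt(1) ab(1) fst_place[OF c(1)]]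
          separated_unique[OF closer_starts_sep lt(2) ab(2) snd_place[OF c(1)]] c(2) by simp_all
      then show "e \<in> (\<lambda>m. place k t (a, b, m)) ` {..<t a b}" using c lt by simp
    next
      fix e assume "e \<in> (\<lambda>m. place k t (a, b, m)) ` {..<t a b}"
      then obtain m where m: "m < t a b" "e = place k t (a, b, m)" by auto
      then have "(a, b, m) \<in> cells k t" using ab unfolding cells_def by simp
      then show "e \<in> R \<inter> ({p a..<q a} \<times> {q b..<p (Suc b)})"
        using fst_place[of a b m] snd_place[of a b m] m(2) by (simp add: mem_Times_iff)
    qed
    moreover have "inj_on (\<lambda>m. place k t (a, b, m)) {..<t a b}"
      by (rule inj_onI) (simp add: place_def offset_def)
    ultimately show ?thesis unfolding count_def by (simp add: card_image)
  qed
  then show ?thesis unfolding psi_blocks by (intro eq_matI) auto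
qed

end

lemma block_counts_of_T:
  assumes A: "A \<in> \<T> n"
  defines "t \<equiv> \<lambda>a b. A $$ (a, b)"
  shows "block_counts (dim_row A) t" "(\<Sum>a<dim_row A. \<Sum>b<dim_row A. t a b) = n"
    "mat (dim_row A) (dim_row A) (\<lambda>(a, b). t a b) = A"
proof -
  define k where "k = dim_row A"
  have sq: "dim_col A = k" "dim_row A = k" using A unfolding \<T>_def k_def by auto
  have rows: "row A a \<noteq> 0\<^sub>v k" and cols: "col A a \<noteq> 0\<^sub>v k" if "a < k" for a
    using A that unfolding \<T>_def by (auto simp: sq)
  show "mat (dim_row A) (dim_row A) (\<lambda>(a, b). t a b) = A"
    unfolding t_def by (intro eq_matI) (auto simp: sq)
  show "(\<Sum>a<dim_row A. \<Sum>b<dim_row A. t a b) = n"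
  proof -
    have "n = sum_mat A" using A unfolding \<T>_def by simp
    then show ?thesis
      unfolding sum_mat_def t_def sq atLeast0LessThan by (simp add: sum.cartesian_product)
  qed
  show "block_counts (dim_row A) t"
    unfolding sq
  proof
    show "t a b = 0" if "b < a" "a < k" for a b
      using A that unfolding \<T>_def t_def by (auto simp: sq)
    show "0 < (\<Sum>b<k. t a b)" if a: "a < k" for a
    proof (rule ccontr)
      assume "\<not> 0 < (\<Sum>b<k. t a b)"
      then have "row A a = 0\<^sub>v k" using a by (intro eq_vecI) (auto simp: sq t_def)
      then show False using rows[OF a] by simp
    qed
    show "0 < (\<Sum>a<k. t a b)" if b: "b < k" for b
    proof (rule ccontr)
      assume "\<not> 0 < (\<Sum>a<k. t a b)"
      then have "col A b = 0\<^sub>v k" using b by (intro eq_vecI) (auto simp: sq t_def)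
      then show False using cols[OF b] by simp
    qed
  qed
qed

theorem theorem10:
  fixes n :: nat
  assumes "n \<ge> 1"
  shows "bij_betw \<psi> {M. matching n M \<and> no_neighbor_crossings M} (\<T> n)"
proof (rule bij_betw_byWitness[where f' = "\<lambda>A. blocks (diagram_of A)"])
  have nested: "nested_diagram n (arcs M) \<and> blocks (arcs M) = M"
    if "matching n M" "no_neighbor_crossings M" for M
    using matching_arc_diagram[OF that(1)] arc_diagram.no_neighbor_crossings_iff that(2) by metis
  show "\<forall>M\<in>{M. matching n M \<and> no_neighbor_crossings M}. blocks (diagram_of (\<psi> M)) = M"
    using nested nested_diagram_reconstructed by (metis (lifting) mem_Collect_eq)
  show "\<psi> ` {M. matching n M \<and> no_neighbor_crossings M} \<subseteq> \<T> n"
  proof (rule image_subsetI, clarify)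
    fix M assume "matching n M" "no_neighbor_crossings M"
    then have *: "nested_diagram n (arcs M)" "blocks (arcs M) = M" using nested by auto
    then obtain k p q where "run_diagram n (arcs M) k p q"
      using arc_diagram.ex_runs nested_diagram.axioms(1) by blast
    then show "\<psi> M \<in> \<T> n" using run_diagram.psi_in_T *(2) by metis
  qed
  show "\<forall>A\<in>\<T> n. \<psi> (blocks (diagram_of A)) = A"
    unfolding diagram_of_def using block_counts.psi_place block_counts_of_T(1,3) by simp
  show "(\<lambda>A. blocks (diagram_of A)) ` \<T> n \<subseteq> {M. matching n M \<and> no_neighbor_crossings M}"
  proof (rule image_subsetI)
    fix A assume "A \<in> \<T> n"
    then have nd: "nested_diagram n (diagram_of A)"
      unfolding diagram_of_def
      using block_counts.nested_diagram_place block_counts_of_T(1,2) by blast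
    then interpret nested_diagram n "diagram_of A" .
    show "blocks (diagram_of A) \<in> {M. matching n M \<and> no_neighbor_crossings M}"
      using matching_blocks no_neighbor_crossings_iff nd by simp
  qed
qed

end
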